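(* Let $f=h+\overline{g}$ be a harmonic entire mapping, where $h(z)=\sum_{n=0}^{\infty}a_nz^n$ and $g(z)=\sum_{n=1}^{\infty}b_nz^n$. If the order of $f$ is $\rho$ (with $0\le\rho\le\infty$), then $\rho=\sigma$, where $$\sigma=\limsup_{n\to\infty}\frac{n\log n}{\log\left[1/(|a_n|+|b_n|)\right]}.$$
   Context: A harmonic entire mapping is a complex-valued harmonic function $f$ on $\mathbb{C}$; it has a canonical decomposition $f=h+\overline{g}$ with $h,g$ entire and $g(0)=0$. For $r>0$ let $M(r,f)=\max_{0\le\theta<2\pi}|f(re^{i\theta})|$. The order of $f$ is $\rho=\limsup_{r\to\infty}\frac{\log\log M(r,f)}{\log r}\in[0,\infty]$; constant functions have order $0$ by convention. In the formula for $\sigma$, a term with $|a_n|+|b_n|=0$ is taken to be $0$ (in particular $\sigma=0$ if $|a_n|+|b_n|=0$ for all large $n$). *)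

theory Defs
  imports "HOL-Complex_Analysis.Complex_Analysis"
begin

definition partial_x :: "(complex \<Rightarrow> complex) \<Rightarrow> complex \<Rightarrow> complex" where
  "partial_x f z = frechet_derivative f (at z) 1"

definition partial_y :: "(complex \<Rightarrow> complex) \<Rightarrow> complex \<Rightarrow> complex" where
  "partial_y f z = frechet_derivative f (at z) \<i>"

text \<open>Differentiability here is over the reals, on the plane.\<close>

definition C1_plane :: "(complex \<Rightarrow> complex) \<Rightarrow> bool" where
  "C1_plane f \<longleftrightarrow> (\<forall>z. f differentiable (at z)) \<and>
     continuous_on UNIV (partial_x f) \<and> continuous_on UNIV (partial_y f)"

definition harmonic_entire :: "(complex \<Rightarrow> complex) \<Rightarrow> bool" where
  "harmonic_entire f \<longleftrightarrow>
     C1_plane f \<and> C1_plane (partial_x f) \<and> C1_plane (partial_y f) \<and>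
     (\<forall>z. partial_x (partial_x f) z + partial_y (partial_y f) z = 0)"

definition canonical_decomposition ::
    "(complex \<Rightarrow> complex) \<Rightarrow> (complex \<Rightarrow> complex) \<Rightarrow> (complex \<Rightarrow> complex) \<Rightarrow> bool" where
  "canonical_decomposition f h g \<longleftrightarrow>
     h holomorphic_on UNIV \<and> g holomorphic_on UNIV \<and> g 0 = 0 \<and>
     (\<forall>z. f z = h z + cnj (g z))"

text \<open>For continuous \<open>f\<close> the supremum is attained, so it is the maximum of
  \<open>\<bar>f\<bar>\<close> on the circle of radius \<open>r\<close>.\<close>

definition max_modulus :: "real \<Rightarrow> (complex \<Rightarrow> complex) \<Rightarrow> real" where
  "max_modulus r f =
     (SUP \<theta>\<in>{0..<2*pi}. cmod (f (of_real r * exp (\<i> * of_real \<theta>))))"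

text \<open>If \<open>f\<close> is harmonic on the plane and not constant, its maximum modulus tends
  to infinity with \<open>r\<close>, so both logarithms are taken of positive reals for all large
  \<open>r\<close>, and the limit superior does not see the values of \<open>ln\<close> at
  nonpositive reals.\<close>

definition growth_order :: "(complex \<Rightarrow> complex) \<Rightarrow> ereal" where
  "growth_order f =
     (if f constant_on UNIV then 0
      else Limsup at_top (\<lambda>r::real. ereal (ln (ln (max_modulus r f)) / ln r)))"

text \<open>Vanishing coefficient pairs contribute the term \<open>0\<close>. The coefficients of an
  entire function tend to \<open>0\<close>, so at most finitely many terms have a denominator
  that is zero or negative, and these do not affect the limit superior.\<close>

definition coeff_order :: "(nat \<Rightarrow> complex) \<Rightarrow> (nat \<Rightarrow> complex) \<Rightarrow> ereal" where
  "coeff_order a b =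
     limsup (\<lambda>n. ereal (if cmod (a n) + cmod (b n) = 0 then 0
       else real n * ln (real n) / ln (1 / (cmod (a n) + cmod (b n)))))"

end

theory Submission
  imports Defs "HOL-Real_Asymp.Real_Asymp"
begin

text \<open>
  Write \<open>c\<^sub>n = \<bar>a\<^sub>n\<bar> + \<bar>b\<^sub>n\<bar>\<close>. On a circle about the origin, \<open>cnj \<circ> g\<close> has
  only nonpositive frequencies, so Cauchy's formula still isolates \<open>a\<^sub>n\<close> from \<open>f\<close>; by
  symmetry the same holds for \<open>b\<^sub>n\<close>. Hence \<open>c\<^sub>n r\<^sup>n \<le> 2 M(r)\<close> for \<open>n \<ge> 1\<close>, while
  trivially \<open>M(r) \<le> \<Sum>c\<^sub>n r\<^sup>n\<close>. As in the classical case, \<open>M(r) \<le> exp (r\<^sup>\<mu>)\<close> with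
  \<open>r = n\<^bsup>1/\<mu>\<^esup>\<close> bounds \<open>c\<^sub>n\<close>; conversely \<open>c\<^sub>n \<le> n\<^bsup>-n/\<mu>\<^esup>\<close> bounds
  every \<open>c\<^sub>n (2r)\<^sup>n\<close> and thereby the power series.
\<close>

section \<open>Coefficient estimates and the maximum modulus\<close>

text \<open>Integrate \<open>h + cnj g\<close> against \<open>1 / cis t ^ n\<close>: the
  \<open>h\<close> part gives the coefficient, and the \<open>g\<close> part is the conjugate of a
  vanishing integral. For \<open>n = 0\<close> it would instead contribute \<open>cnj (g 0)\<close>.
  The statement also serves with \<open>h\<close> and \<open>g\<close> exchanged.\<close>

lemma norm_higher_deriv_le_harmonic:
  assumes h: "h holomorphic_on UNIV" and g: "g holomorphic_on UNIV"
    and r: "0 < r" and n: "0 < n"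
    and bound: "\<And>z. cmod z = r \<Longrightarrow> cmod (h z + cnj (g z)) \<le> M"
  shows "cmod ((deriv ^^ n) h 0 / fact n) * r ^ n \<le> M"
proof -
  define c where "c = (deriv ^^ n) h 0 / fact n"
  have M: "0 \<le> M"
    using order_trans[OF norm_ge_zero bound[of "of_real r"]] r by simp
  have "((\<lambda>u. h u / (u - 0) ^ Suc n) has_contour_integral
      ((2 * pi * \<i>) / fact n * (deriv ^^ n) h 0)) (circlepath 0 r)"
    using r h by (intro Cauchy_has_contour_integral_higher_derivative_circlepath)
      (auto intro: holomorphic_on_subset holomorphic_on_imp_continuous_on)
  then have "((\<lambda>t. h (r * cis t) / (r * cis t) ^ Suc n * r * \<i> * cis t)
      has_integral (2 * pi * \<i> * c)) {0..2*pi}"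
    unfolding circlepath_def c_def
    by (subst (asm) has_contour_integral_part_circlepath_iff) (auto simp: field_simps)
  from has_integral_mult_right[OF this, of "of_real r ^ n / \<i>"]
  have H: "((\<lambda>t. h (r * cis t) / cis t ^ n) has_integral (2 * pi * c * r ^ n)) {0..2*pi}"
    using r by (simp add: field_simps)
  \<comment> \<open>The exponent drops by one because the differential along the circle supplies the
    remaining factor \<open>cis t\<close>.\<close>
  obtain m where m: "n = Suc m"
    using n not0_implies_Suc by blast
  have "((\<lambda>z. g z * z ^ m) has_contour_integral 0) (circlepath 0 r)"
    using g by (intro Cauchy_theorem_convex_simple[of _ UNIV])
      (auto intro!: holomorphic_intros)
  then have "((\<lambda>t. g (r * cis t) * (r * cis t) ^ m * r * \<i> * cis t) has_integral 0) {0..2*pi}"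
    unfolding circlepath_def
    by (subst (asm) has_contour_integral_part_circlepath_iff) (auto simp: field_simps)
  from has_integral_mult_right[OF this, of "1 / (\<i> * of_real r ^ n)"]
  have "((\<lambda>t. g (r * cis t) * cis t ^ n) has_integral 0) {0..2*pi}"
    using r by (simp add: field_simps m)
  then have "((\<lambda>t. cnj (g (r * cis t) * cis t ^ n)) has_integral 0) {0..2*pi}"
    using has_integral_cnj[of "\<lambda>t. g (r * cis t) * cis t ^ n" 0] by (simp add: o_def)
  then have G: "((\<lambda>t. cnj (g (r * cis t)) / cis t ^ n) has_integral 0) {0..2*pi}"
    by (simp add: cis_cnj divide_inverse flip: power_inverse)
  have "((\<lambda>t. (h (r * cis t) + cnj (g (r * cis t))) / cis t ^ n)
      has_integral (2 * pi * c * r ^ n)) (cbox 0 (2*pi))"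
    using has_integral_add[OF H G] by (simp add: add_divide_distrib)
  then have "cmod (complex_of_real (2 * pi) * c * of_real (r ^ n)) \<le> M * measure lborel (cbox 0 (2*pi))"
    by (rule has_integral_bound[OF M])
      (use r in \<open>auto simp: norm_divide norm_power norm_mult intro!: bound\<close>)
  then have "2 * pi * (cmod c * r ^ n) \<le> 2 * pi * M"
    using r by (simp add: norm_mult norm_power mult_ac)
  then show ?thesis
    unfolding c_def by simp
qed

lemma powser_coeff_eq_higher_deriv:
  fixes a :: "nat \<Rightarrow> complex"
  assumes "\<And>z. (\<lambda>n. a n * z ^ n) sums h z"
  shows "a n = (deriv ^^ n) h 0 / fact n"
proof -
  have "h has_fps_expansion Abs_fps a"
    by (rule has_fps_expansionI) (simp add: assms)
  from fps_nth_fps_expansion[OF this, of n] show ?thesis by simp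
qed

lemma cmod_le_max_modulus:
  assumes "continuous_on UNIV f"
  shows "cmod (f z) \<le> max_modulus (cmod z) f"
proof -
  \<comment> \<open>The half-open parameter interval is not compact, so boundedness is obtained on
    its closure.\<close>
  have "compact ((\<lambda>\<theta>. cmod (f (of_real (cmod z) * exp (\<i> * of_real \<theta>)))) ` {0..2*pi})"
    by (intro compact_continuous_image continuous_intros continuous_on_compose2[OF assms]) auto
  then have "bdd_above ((\<lambda>\<theta>. cmod (f (of_real (cmod z) * exp (\<i> * of_real \<theta>)))) ` {0..2*pi})"
    by (intro bounded_imp_bdd_above compact_imp_bounded)
  then have "bdd_above ((\<lambda>\<theta>. cmod (f (of_real (cmod z) * exp (\<i> * of_real \<theta>)))) ` {0..<2*pi})"
    by (rule bdd_above_mono) auto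
  then have "cmod (f (of_real (cmod z) * exp (\<i> * of_real (Arg2pi z)))) \<le> max_modulus (cmod z) f"
    unfolding max_modulus_def by (rule cSUP_upper[rotated]) (simp add: Arg2pi)
  then show ?thesis
    using Arg2pi[of z] by (simp add: is_Arg_def)
qed

lemma max_modulus_le:
  assumes "0 \<le> r" and "\<And>z. cmod z = r \<Longrightarrow> cmod (f z) \<le> B"
  shows "max_modulus r f \<le> B"
  unfolding max_modulus_def using assms
  by (intro cSUP_least) (auto simp: norm_mult)

section \<open>Comparing growth with coefficient decay\<close>

text \<open>Spares a separate treatment of infinite order: for infinite \<open>y\<close> the premise
  is vacuous, and otherwise all estimates use a finite exponent.\<close>

lemma ereal_le_if_real_upper_bounds:
  fixes x y :: ereal
  assumes "\<And>\<mu>::real. y < ereal \<mu> \<Longrightarrow> x \<le> ereal \<mu>"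
  shows "x \<le> y"
proof (rule dense_ge)
  fix w assume w: "y < w"
  show "x \<le> w"
  proof (cases w)
    case (real \<mu>)
    then show ?thesis using assms w by simp
  qed (use w in auto)
qed

lemma limsup_coeff_le_order:
  fixes c :: "nat \<Rightarrow> real" and M :: "real \<Rightarrow> real"
  assumes c: "\<And>n. 0 \<le> c n"
    and cauchy: "\<And>n r. 0 < n \<Longrightarrow> 0 < r \<Longrightarrow> c n * r ^ n \<le> 2 * M r"
    and pos: "\<And>r. 0 < r \<Longrightarrow> 0 < M r"
    and nonneg: "0 \<le> Limsup at_top (\<lambda>r. ereal (ln (ln (M r)) / ln r))"
  shows "limsup (\<lambda>n. ereal (if c n = 0 then 0 else real n * ln (real n) / ln (1 / c n)))
    \<le> Limsup at_top (\<lambda>r. ereal (ln (ln (M r)) / ln r))" (is "limsup ?s \<le> ?\<rho>")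
proof (rule ereal_le_if_real_upper_bounds)
  fix \<mu> :: real assume \<mu>: "?\<rho> < ereal \<mu>"
  with nonneg have "0 < ereal \<mu>"
    by (rule order_le_less_trans)
  then have \<mu>0: "0 < \<mu>" by simp
  have "\<forall>\<^sub>F r in at_top. ln (ln (M r)) / ln r < \<mu>"
    using Limsup_lessD[OF \<mu>] by simp
  with eventually_gt_at_top[of 1] have M_le: "\<forall>\<^sub>F r in at_top. M r \<le> exp (r powr \<mu>)"
  proof eventually_elim
    case (elim r)
    then have "ln (ln (M r)) < \<mu> * ln r"
      by (simp add: field_simps)
    \<comment> \<open>The outer logarithm can be undone only where \<open>ln (M r)\<close> is
      positive; elsewhere the bound is trivial.\<close>
    have "ln (M r) \<le> r powr \<mu>"
    proof (cases "0 < ln (M r)")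
      case True
      then have "ln (M r) < exp (\<mu> * ln r)"
        using \<open>ln (ln (M r)) < \<mu> * ln r\<close> by (metis exp_less_mono exp_ln)
      then show ?thesis using elim by (simp add: powr_def)
    next
      case False
      then show ?thesis by (simp add: order_trans[of _ 0])
    qed
    then show ?case
      using pos[of r] elim by (metis exp_le_cancel_iff exp_ln less_trans zero_less_one)
  qed
  \<comment> \<open>The radius \<open>n powr (1/\<mu>)\<close> gives
    \<open>c n \<le> 2 * exp n / n powr (n/\<mu>)\<close>, and the denominator is minus the
    logarithm of this bound. Since \<open>n\<close> and \<open>ln 2\<close> are of lower order than
    \<open>n * ln n\<close>, the limit is \<mu>.\<close>
  define t where "t n = real n * ln (real n) / (real n / \<mu> * ln (real n) - real n - ln 2)" for n :: nat
  have lim: "t \<longlonglongrightarrow> \<mu>"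
    unfolding t_def using \<mu>0 by real_asymp
  have "filterlim (\<lambda>n. real n powr (1/\<mu>)) at_top sequentially"
    using \<mu>0 by real_asymp
  with M_le have M_le': "\<forall>\<^sub>F n in sequentially. M (real n powr (1/\<mu>)) \<le> exp ((real n powr (1/\<mu>)) powr \<mu>)"
    by (rule eventually_compose_filterlim)
  have "\<forall>\<^sub>F n in sequentially. real n / \<mu> * ln (real n) - real n - ln 2 > 0"
    using \<mu>0 by real_asymp
  with M_le' eventually_gt_at_top[of 1] have "\<forall>\<^sub>F n in sequentially. ?s n \<le> ereal (t n)"
  proof eventually_elim
    case (elim n)
    show ?case
    proof (cases "c n = 0")
      case True
      then show ?thesis using elim by (simp add: t_def)
    next
      case False
      then have cn: "0 < c n" using c[of n] by simp
      have "c n * (real n powr (1/\<mu>)) ^ n \<le> 2 * M (real n powr (1/\<mu>))"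
        using elim by (intro cauchy) auto
      also have "\<dots> \<le> 2 * exp (real n)"
        using elim \<mu>0 by (simp add: powr_powr)
      finally have "ln (c n * (real n powr (1/\<mu>)) ^ n) \<le> ln (2 * exp (real n))"
        using cn elim by (subst ln_le_cancel_iff) auto
      then have "ln (c n) + real n / \<mu> * ln (real n) \<le> ln 2 + real n"
        using cn elim by (simp add: ln_mult ln_realpow ln_powr)
      then have "real n / \<mu> * ln (real n) - real n - ln 2 \<le> ln (1 / c n)"
        using cn by (simp add: ln_div)
      then show ?thesis
        using elim False by (auto simp: t_def intro!: divide_left_mono mult_pos_pos)
    qed
  qed
  then have "limsup ?s \<le> limsup (\<lambda>n. ereal (t n))"
    by (rule Limsup_mono)
  also have "\<dots> = ereal \<mu>"
    using lim by (intro lim_imp_Limsup) auto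
  finally show "limsup ?s \<le> ereal \<mu>" .
qed

lemma order_le_limsup_coeff:
  fixes c :: "nat \<Rightarrow> real" and M :: "real \<Rightarrow> real"
  assumes c: "\<And>n. 0 \<le> c n"
    and tendsto0: "c \<longlonglongrightarrow> 0"
    and M: "\<And>r. 0 < r \<Longrightarrow> M r \<le> (\<Sum>n. c n * r ^ n)"
    and top: "filterlim M at_top at_top"
  shows "Limsup at_top (\<lambda>r. ereal (ln (ln (M r)) / ln r))
    \<le> limsup (\<lambda>n. ereal (if c n = 0 then 0 else real n * ln (real n) / ln (1 / c n)))"
    (is "?\<rho> \<le> limsup ?s")
proof (rule ereal_le_if_real_upper_bounds)
  fix \<mu>' :: real assume \<mu>': "limsup ?s < ereal \<mu>'"
  \<comment> \<open>Below 1 the logarithm of \<open>1 / c n\<close> is positive for nonzero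
    \<open>c n\<close>, so the terms are nonnegative and the quotient bound can be cleared of its
    denominator.\<close>
  have c1: "\<forall>\<^sub>F n in sequentially. c n < 1"
    using order_tendstoD(2)[OF tendsto0, of 1] by simp
  with eventually_gt_at_top[of 0] have "\<forall>\<^sub>F n in sequentially. 0 \<le> ?s n"
  proof eventually_elim
    case (elim n)
    then have "0 \<le> ln (1 / c n)" if "c n \<noteq> 0"
      using that c[of n] by (intro ln_ge_zero) simp
    then show ?case using elim by simp
  qed
  then have "0 \<le> limsup ?s"
    by (rule le_Limsup[OF sequentially_bot])
  \<comment> \<open>The gap between the two exponents later absorbs every constant.\<close>
  with \<mu>' obtain \<mu> where \<mu>: "limsup ?s < ereal \<mu>" "ereal \<mu> < ereal \<mu>'"
    by (meson ereal_dense2)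
  with \<open>0 \<le> limsup ?s\<close> have "0 < ereal \<mu>"
    by (meson order_le_less_trans)
  then have \<mu>0: "0 < \<mu>" by simp
  have "\<forall>\<^sub>F n in sequentially. ?s n < ereal \<mu>"
    using Limsup_lessD[OF \<mu>(1)] .
  \<comment> \<open>The bound does not depend on \<open>n\<close>, and its threshold does not depend
    on \<open>R\<close>, so one expression controls the whole tail.\<close>
  with c1 eventually_gt_at_top[of 0]
  have "\<forall>\<^sub>F n in sequentially. \<forall>R>0. c n * R ^ n \<le> exp (R powr \<mu> / \<mu>)"
  proof eventually_elim
    case (elim n)
    show ?case
    proof (intro allI impI)
      fix R :: real assume R: "0 < R"
      show "c n * R ^ n \<le> exp (R powr \<mu> / \<mu>)"
      proof (cases "c n = 0")
        case False
        then have cn: "0 < c n" using c[of n] by simp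
        have "0 < ln (1 / c n)" using cn elim by (simp add: ln_div)
        then have "real n * ln (real n) < \<mu> * ln (1 / c n)"
          using elim False by (simp add: pos_divide_less_eq)
        then have A: "ln (c n) \<le> - (real n / \<mu> * ln (real n))"
          using cn \<mu>0 by (simp add: ln_div field_simps)
        \<comment> \<open>\<open>ln y \<le> y\<close> replaces the maximisation of \<open>R\<^sup>n n\<^bsup>-n/\<mu>\<^esup>\<close> over \<open>n\<close>, at the cost of a
          constant in the exponent.\<close>
        have "ln (R powr \<mu> / real n) \<le> R powr \<mu> / real n"
          using R elim by (intro order_trans[OF ln_le_minus_one]) auto
        then have "\<mu> * ln R - ln (real n) \<le> R powr \<mu> / real n"
          using R elim by (simp add: ln_div ln_powr)
        then have "real n / \<mu> * (\<mu> * ln R - ln (real n)) \<le> real n / \<mu> * (R powr \<mu> / real n)"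
          using \<mu>0 by (intro mult_left_mono) auto
        then have B: "real n * ln R - real n / \<mu> * ln (real n) \<le> R powr \<mu> / \<mu>"
          using elim \<mu>0 by (simp add: field_simps)
        have "c n * R ^ n = exp (ln (c n) + real n * ln R)"
          using cn R by (simp add: exp_add exp_of_nat_mult)
        also have "\<dots> \<le> exp (R powr \<mu> / \<mu>)"
          using A B by simp
        finally show ?thesis .
      qed simp
    qed
  qed
  then obtain N where N: "\<And>n R. N \<le> n \<Longrightarrow> 0 < R \<Longrightarrow> c n * R ^ n \<le> exp (R powr \<mu> / \<mu>)"
    by (auto simp: eventually_sequentially)
  \<comment> \<open>\<open>K * R ^ N\<close> covers the finitely many initial terms once
    \<open>R \<ge> 1\<close>; the added 1 keeps \<open>K\<close> positive even if those coefficients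
    vanish.\<close>
  define K where "K = (\<Sum>n<N. c n) + 1"
  have K0: "0 < K" unfolding K_def using c by (intro add_nonneg_pos sum_nonneg) auto
  define B where "B R = K * R ^ N + exp (R powr \<mu> / \<mu>)" for R
  have cB: "c n * R ^ n \<le> B R" if R: "1 \<le> R" for n R
  proof (cases "n < N")
    case True
    have "c n \<le> (\<Sum>n<N. c n)"
      using True c by (intro member_le_sum) auto
    then have "c n * R ^ n \<le> K * R ^ N"
      using True R K0 by (intro mult_mono power_increasing) (auto simp: K_def)
    then show ?thesis unfolding B_def by (simp add: add_increasing2)
  next
    case False
    then show ?thesis
      using N[of n R] R K0 by (simp add: B_def add_increasing)
  qed
  \<comment> \<open>Using the termwise bound at the doubled radius leaves a factor
    \<open>(1/2) ^ n\<close>, so the series is dominated by a geometric one.\<close>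
  have M_le: "M r \<le> 2 * B (2 * r)" if r: "1 \<le> r" for r
  proof -
    have le: "c n * r ^ n \<le> B (2 * r) * (1/2) ^ n" for n
      using cB[of "2*r" n] r by (simp add: power_mult_distrib field_simps)
    have sm: "summable (\<lambda>n. B (2 * r) * (1/2) ^ n)"
      by (intro summable_mult summable_geometric) simp
    have "M r \<le> (\<Sum>n. c n * r ^ n)"
      using M r by simp
    also have "\<dots> \<le> (\<Sum>n. B (2 * r) * (1/2) ^ n)"
      using r c le by (intro suminf_le summable_comparison_test[OF _ sm] sm exI[of _ 0]) auto
    also have "\<dots> = 2 * B (2 * r)"
      by (subst suminf_mult) (auto simp: suminf_geometric)
    finally show ?thesis .
  qed
  \<comment> \<open>Each of the two summands of \<open>B\<close> is allowed a quarter, which the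
    factor 2 turns into the full bound.\<close>
  have "\<forall>\<^sub>F r in at_top. 2 * B (2 * r) \<le> exp (r powr \<mu>')"
  proof -
    have "\<mu> < \<mu>'" using \<mu> by simp
    have "\<forall>\<^sub>F r::real in at_top. K * (2 * r) ^ N \<le> exp (r powr \<mu>') / 4"
      using K0 \<mu>0 \<open>\<mu> < \<mu>'\<close> by real_asymp
    moreover have "\<forall>\<^sub>F r::real in at_top. exp ((2 * r) powr \<mu> / \<mu>) \<le> exp (r powr \<mu>') / 4"
      using \<mu>0 \<open>\<mu> < \<mu>'\<close> by real_asymp
    ultimately show ?thesis
      by eventually_elim (simp add: B_def)
  qed
  moreover have "\<forall>\<^sub>F r in at_top. 1 < M r"
    using top by (simp add: filterlim_at_top_dense)
  ultimately have "\<forall>\<^sub>F r in at_top. ereal (ln (ln (M r)) / ln r) \<le> ereal \<mu>'"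
    using eventually_gt_at_top[of 1]
  proof eventually_elim
    case (elim r)
    then have "M r \<le> exp (r powr \<mu>')"
      using M_le[of r] by simp
    then have "ln (M r) \<le> ln (exp (r powr \<mu>'))"
      using elim by (subst ln_le_cancel_iff) auto
    then have "ln (M r) \<le> r powr \<mu>'"
      by (simp only: ln_exp)
    moreover have "0 < ln (M r)"
      using elim by simp
    ultimately have "ln (ln (M r)) \<le> ln (r powr \<mu>')"
      by (metis less_le_trans ln_le_cancel_iff)
    also have "\<dots> = \<mu>' * ln r"
      by (rule ln_powr)
    finally have "ln (ln (M r)) \<le> \<mu>' * ln r" .
    then show ?case
      using elim by (simp add: field_simps)
  qed
  then show "?\<rho> \<le> ereal \<mu>'"
    by (rule Limsup_bounded)
qed

section \<open>Application to harmonic entire mappings\<close>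

theorem theorem1:
  fixes f h g :: "complex \<Rightarrow> complex" and a b :: "nat \<Rightarrow> complex"
  assumes "harmonic_entire f"
    and "canonical_decomposition f h g"
    and "\<And>z. (\<lambda>n. a n * z ^ n) sums h z"
    and "\<And>z. (\<lambda>n. b (Suc n) * z ^ Suc n) sums g z"
  shows "growth_order f = coeff_order a b"
proof -
  define c where "c n = cmod (a n) + cmod (b n)" for n
  \<comment> \<open>The hypotheses leave \<open>b 0\<close> unconstrained.\<close>
  define b' where "b' n = (if n = 0 then 0 else b n)" for n
  have h: "h holomorphic_on UNIV" and g: "g holomorphic_on UNIV" and f: "f = (\<lambda>z. h z + cnj (g z))"
    using assms(2) by (auto simp: canonical_decomposition_def)
  have cont: "continuous_on UNIV f"
    unfolding f by (intro continuous_intros holomorphic_on_imp_continuous_on h g)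
  have g_sums: "(\<lambda>n. b' n * z ^ n) sums g z" for z
    using assms(4)[of z] sums_Suc_iff[of "\<lambda>n. b' n * z ^ n" "g z"] by (simp add: b'_def)
  have a_eq: "a n = (deriv ^^ n) h 0 / fact n" for n
    using assms(3) by (rule powser_coeff_eq_higher_deriv)
  have b_eq: "b n = (deriv ^^ n) g 0 / fact n" if "0 < n" for n
    using powser_coeff_eq_higher_deriv[of b' g n] g_sums that by (simp add: b'_def)
  have cauchy: "c n * r ^ n \<le> 2 * max_modulus r f" if n: "0 < n" and r: "0 < r" for n r
  proof -
    have *: "cmod (h z + cnj (g z)) \<le> max_modulus r f" if "cmod z = r" for z
      using cmod_le_max_modulus[OF cont, of z] that by (simp add: f)
    \<comment> \<open>Conjugating \<open>f\<close> swaps \<open>h\<close> and \<open>g\<close>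
      without changing the modulus, so one lemma bounds both coefficients.\<close>
    have "cmod (g z + cnj (h z)) = cmod (h z + cnj (g z))" for z
      using complex_mod_cnj[of "h z + cnj (g z)"] by (simp add: add.commute)
    with * have "cmod (a n) * r ^ n \<le> max_modulus r f" "cmod (b n) * r ^ n \<le> max_modulus r f"
      unfolding a_eq b_eq[OF n]
      by (intro norm_higher_deriv_le_harmonic[OF h g r n] norm_higher_deriv_le_harmonic[OF g h r n]; simp)+
    then show ?thesis
      by (simp add: c_def algebra_simps)
  qed
  have c0: "0 \<le> c n" for n
    by (simp add: c_def)
  have coeff: "coeff_order a b =
      limsup (\<lambda>n. ereal (if c n = 0 then 0 else real n * ln (real n) / ln (1 / c n)))"
    unfolding coeff_order_def c_def ..
  show ?thesis
  proof (cases "f constant_on UNIV")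
    case True
    then obtain k where k: "\<And>z. f z = k"
      by (auto simp: constant_on_def)
    have "max_modulus r f \<le> cmod k" if "0 < r" for r
      using that k by (intro max_modulus_le) auto
    \<comment> \<open>A nonzero \<open>c n\<close> would make the maximum modulus unbounded. Only
      \<open>c 0\<close> may survive, and the limit superior ignores it, in agreement with order 0
      for constants.\<close>
    have "c n = 0" if n: "0 < n" for n
    proof (rule ccontr)
      assume "c n \<noteq> 0"
      then have "0 < c n" using c0[of n] by simp
      then have "filterlim (\<lambda>r. c n * r ^ n) at_top at_top"
        using n by real_asymp
      then have "\<forall>\<^sub>F r in at_top. 2 * cmod k < c n * r ^ n"
        by (simp add: filterlim_at_top_dense)
      with eventually_gt_at_top[of 0] have "\<forall>\<^sub>F r :: real in at_top. False"
      proof eventually_elim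
        case (elim r)
        then show ?case
          using cauchy[OF n, of r] \<open>\<And>r. 0 < r \<Longrightarrow> max_modulus r f \<le> cmod k\<close>[of r] by simp
      qed
      then show False by simp
    qed
    then have "\<forall>\<^sub>F n in sequentially.
        ereal (if c n = 0 then 0 else real n * ln (real n) / ln (1 / c n)) = 0"
      by (intro eventually_sequentiallyI[of 1]) simp
    then have "coeff_order a b = limsup (\<lambda>n. 0)"
      unfolding coeff by (rule Limsup_eq)
    then show ?thesis
      using True by (simp add: growth_order_def Limsup_const)
  next
    case False
    \<comment> \<open>This single index yields both the positivity of the maximum modulus and its
      divergence, through the Cauchy estimate.\<close>
    have "\<exists>m>0. 0 < c m"
    proof (rule ccontr)
      assume "\<not> ?thesis"
      then have "c m = 0" if "0 < m" for m
        using c0[of m] that by (meson antisym not_le)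
      then have z: "a m = 0" "b' m = 0" if "0 < m" for m
        using that by (auto simp: c_def b'_def add_nonneg_eq_0_iff)
      have "h z = a 0" for z
        using sums_unique2[OF assms(3)[of z], of "a 0"] sums_finite[of "{0}" "\<lambda>n. a n * z ^ n"] z by simp
      moreover have "g z = b' 0" for z
        using sums_unique2[OF g_sums[of z], of "b' 0"] sums_finite[of "{0}" "\<lambda>n. b' n * z ^ n"] z by simp
      ultimately show False
        using False by (auto simp: constant_on_def f)
    qed
    then obtain m where m: "0 < m" "0 < c m" by blast
    have pos: "0 < max_modulus r f" if "0 < r" for r
    proof -
      have "0 < c m * r ^ m" using m that by simp
      also have "\<dots> \<le> 2 * max_modulus r f" using cauchy m that by simp
      finally show ?thesis by simp
    qed
    have top: "filterlim (\<lambda>r. max_modulus r f) at_top at_top"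
    proof (rule filterlim_at_top_mono)
      show "filterlim (\<lambda>r. c m * r ^ m / 2) at_top at_top"
        using m by real_asymp
      show "\<forall>\<^sub>F r in at_top. c m * r ^ m / 2 \<le> max_modulus r f"
        using eventually_gt_at_top[of 0]
      proof eventually_elim
        case (elim r)
        then show ?case using cauchy[of m r] m by simp
      qed
    qed
    have sum_a: "summable (\<lambda>n. cmod (a n) * r ^ n)" and sum_b: "summable (\<lambda>n. cmod (b' n) * r ^ n)"
      if "0 < r" for r
    proof -
      \<comment> \<open>Convergence at the larger radius \<open>r + 1\<close> gives absolute
        convergence at \<open>r\<close>.\<close>
      have "summable (\<lambda>n. cmod (a n * of_real r ^ n))"
        using sums_summable[OF assms(3)] that
        by (intro powser_insidea[of a "of_real (r + 1)"]) (simp_all del: of_real_add)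
      then show "summable (\<lambda>n. cmod (a n) * r ^ n)"
        using that by (simp add: norm_mult norm_power)
      have "summable (\<lambda>n. cmod (b' n * of_real r ^ n))"
        using sums_summable[OF g_sums] that
        by (intro powser_insidea[of b' "of_real (r + 1)"]) (simp_all del: of_real_add)
      then show "summable (\<lambda>n. cmod (b' n) * r ^ n)"
        using that by (simp add: norm_mult norm_power)
    qed
    have sum_c: "summable (\<lambda>n. c n * r ^ n)" if "0 < r" for r
    proof -
      have "summable (\<lambda>n. cmod (a n) * r ^ n + cmod (b' n) * r ^ n)"
        using that by (intro summable_add sum_a sum_b)
      moreover have "\<forall>\<^sub>F n in sequentially. cmod (a n) * r ^ n + cmod (b' n) * r ^ n = c n * r ^ n"
        by (intro eventually_sequentiallyI[of 1]) (simp add: c_def b'_def algebra_simps)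
      ultimately show ?thesis
        by (subst (asm) summable_cong) auto
    qed
    have max_le: "max_modulus r f \<le> (\<Sum>n. c n * r ^ n)" if r: "0 < r" for r
    proof (rule max_modulus_le)
      fix z :: complex assume z: "cmod z = r"
      have "cmod (f z) \<le> cmod (h z) + cmod (g z)"
        unfolding f using norm_triangle_ineq[of "h z" "cnj (g z)"] by simp
      also have "\<dots> \<le> (\<Sum>n. cmod (a n) * r ^ n) + (\<Sum>n. cmod (b' n) * r ^ n)"
        using summable_norm[of "\<lambda>n. a n * z ^ n"] summable_norm[of "\<lambda>n. b' n * z ^ n"]
          sum_a[OF r] sum_b[OF r] assms(3)[of z] g_sums[of z]
        by (simp add: sums_iff norm_mult norm_power z)
      also have "\<dots> = (\<Sum>n. cmod (a n) * r ^ n + cmod (b' n) * r ^ n)"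
        using r by (intro suminf_add sum_a sum_b)
      \<comment> \<open>Only an inequality holds at index 0, where \<open>c\<close> includes the
        arbitrary \<open>b 0\<close>.\<close>
      also have "\<dots> \<le> (\<Sum>n. c n * r ^ n)"
        using r by (intro suminf_le summable_add sum_a sum_b sum_c)
          (auto simp: c_def b'_def algebra_simps)
      finally show "cmod (f z) \<le> (\<Sum>n. c n * r ^ n)" .
    qed (use r in simp)
    have "c \<longlonglongrightarrow> 0"
      using summable_LIMSEQ_zero[OF sum_c[of 1]] by simp
    note upper = order_le_limsup_coeff[of c "\<lambda>r. max_modulus r f", OF c0 this max_le top]
    \<comment> \<open>Beyond \<open>exp 1\<close> the iterated logarithm is nonnegative, so the
      order is too, as the lower estimate requires.\<close>
    have "\<forall>\<^sub>F r in at_top. exp 1 < max_modulus r f"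
      using top by (simp add: filterlim_at_top_dense)
    with eventually_gt_at_top[of 1]
    have "\<forall>\<^sub>F r in at_top. 0 \<le> ereal (ln (ln (max_modulus r f)) / ln r)"
    proof eventually_elim
      case (elim r)
      then have "1 \<le> ln (max_modulus r f)"
        using pos[of r] by (simp add: ln_ge_iff)
      then show ?case using elim by simp
    qed
    then have "0 \<le> Limsup at_top (\<lambda>r. ereal (ln (ln (max_modulus r f)) / ln r))"
      by (intro le_Limsup) auto
    note lower = limsup_coeff_le_order[of c "\<lambda>r. max_modulus r f", OF c0 cauchy pos this]
    show ?thesis
      unfolding coeff growth_order_def if_not_P[OF False] using upper lower by (rule antisym)
  qed
qed

end
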